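(* Let $m\ge 1$ be an integer, let $z_0,\dots,z_m\in\mathbb{C}$ be pairwise distinct, and let $w_0,\dots,w_m\in\mathbb{C}$ all be nonzero. Let $$r_j(z)=\frac{\frac{w_j}{z-z_j}}{\sum_{i=0}^m\frac{w_i}{z-z_i}}\quad (j=0,\dots,m).$$ For $j=1,\dots,m$ let $\sigma_{j-1}:=z_{j-1}$ and let $\beta_j,h_j,k_j\in\mathbb{C}$ with $\beta_j\ne0$ be any numbers satisfying $$\beta_jk_j=-\frac{w_{j-1}}{w_j},\qquad \beta_jh_j=-\frac{z_jw_{j-1}}{w_j}.$$ Let $\underline{M_m},\underline{N_m}\in\mathbb{C}^{(m+1)\times m}$ be the lower bidiagonal matrices whose $j$-th columns ($j=1,\dots,m$, rows numbered $1,\dots,m+1$) have, in rows $j$ and $j+1$ respectively, the entries $1$ and $\beta_jk_j$ (for $\underline{M_m}$), and $\sigma_{j-1}$ and $\beta_jh_j$ (for $\underline{N_m}$), with zeros elsewhere. Then, as an identity of rational functions in $z$, $$z\,[r_0(z),r_1(z),\dots,r_m(z)]\,\underline{M_m}=[r_0(z),r_1(z),\dots,r_m(z)]\,\underline{N_m}.$$ That is, the functions $r_j$ satisfy the rational Newton recursion $$r_j(z)=\frac{z-\sigma_{j-1}}{\beta_j(h_j-k_jz)}\,r_{j-1}(z),\qquad j=1,\dots,m,$$ with parameters satisfying $\beta_j\ne0$, $|h_j|+|k_j|\neq0$ and $\sigma_{j-1}\ne h_j/k_j$ for all $j=1,\dots,m$ (the only difference from a rational Newton basis being that $r_0$ is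 not necessarily constant).
   Context: A rational Newton basis $b_0,\dots,b_m$ is a sequence of rational functions given by $b_0\equiv1$ and $b_j(z)=\frac{z-\sigma_{j-1}}{\beta_j(h_j-k_jz)}b_{j-1}(z)$ for $j=1,\dots,m$, with complex scalars satisfying $\beta_j\neq0$, $|h_j|+|k_j|\ne0$ and $\sigma_{j-1}\neq h_j/k_j$ for all $j$. The functions $r_j$ are the basis functions of the barycentric rational interpolant $r(z)=\sum_{j=0}^m f_jr_j(z)$ with nodes $z_j$, weights $w_j$ and values $f_j$. *)

theory Defs
  imports
    Complex_Main
    "HOL-Computational_Algebra.Polynomial_Factorial"
    "Jordan_Normal_Form.Matrix"
begin

text \<open>The field of rational functions in one indeterminate over the complex numbers.\<close>

type_synonym ratfun = "complex poly fract"

definition rconst :: "complex \<Rightarrow> ratfun" where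
  "rconst c = to_fract [:c:]"

definition rvar :: ratfun where
  "rvar = to_fract [:0, 1:]"

definition bary_basis :: "nat \<Rightarrow> (nat \<Rightarrow> complex) \<Rightarrow> (nat \<Rightarrow> complex) \<Rightarrow> nat \<Rightarrow> ratfun" where
  "bary_basis m z w j =
     (rconst (w j) / (rvar - rconst (z j))) /
     (\<Sum>i = 0..m. rconst (w i) / (rvar - rconst (z i)))"

definition bary_row :: "nat \<Rightarrow> (nat \<Rightarrow> complex) \<Rightarrow> (nat \<Rightarrow> complex) \<Rightarrow> ratfun mat" where
  "bary_row m z w = mat_of_row (vec (m + 1) (bary_basis m z w))"

text \<open>Rows and columns of matrices are numbered from 0: the column with index \<open>j\<close> below is
  the mathematical column \<open>j + 1\<close>, and it is built from the parameters \<open>\<sigma>\<close> of index \<open>j\<close>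
  and \<open>\<beta>, h, k\<close> of index \<open>j + 1\<close>.\<close>

definition newton_M :: "nat \<Rightarrow> (nat \<Rightarrow> complex) \<Rightarrow> (nat \<Rightarrow> complex) \<Rightarrow> complex mat" where
  "newton_M m \<beta> k = mat (m + 1) m
     (\<lambda>(i, j). if i = j then 1 else if i = j + 1 then \<beta> (j + 1) * k (j + 1) else 0)"

definition newton_N ::
  "nat \<Rightarrow> (nat \<Rightarrow> complex) \<Rightarrow> (nat \<Rightarrow> complex) \<Rightarrow> (nat \<Rightarrow> complex) \<Rightarrow> complex mat" where
  "newton_N m \<sigma> \<beta> h = mat (m + 1) m
     (\<lambda>(i, j). if i = j then \<sigma> j else if i = j + 1 then \<beta> (j + 1) * h (j + 1) else 0)"

end

theory Submission
  imports Defs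
begin

text \<open>Substituting the parameters gives
  \<open>\<beta>\<^sub>j (h\<^sub>j - k\<^sub>j x) = (w\<^sub>j\<^sub>-\<^sub>1 / w\<^sub>j) (x - z\<^sub>j)\<close>. The common denominator of the barycentric
  functions cancels in \<open>r\<^sub>j / r\<^sub>j\<^sub>-\<^sub>1\<close>, which leaves exactly the Newton recursion; cleared of its
  denominator, the recursion for \<open>r\<^sub>j\<close> is the \<open>j\<close>-th column of the matrix identity.\<close>

lemma rconst_0 [simp]: "rconst 0 = 0"
  by (simp add: rconst_def)

lemma rconst_1 [simp]: "rconst 1 = 1"
  by (simp add: rconst_def one_pCons[symmetric])

lemma rconst_mult: "rconst (a * b) = rconst a * rconst b"
  by (simp add: rconst_def flip: to_fract_mult)

lemma rconst_uminus: "rconst (- a) = - rconst a"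
  by (simp add: rconst_def flip: to_fract_uminus)

lemma rconst_eq_0_iff [simp]: "rconst a = 0 \<longleftrightarrow> a = 0"
  by (simp add: rconst_def)

lemma rvar_minus_rconst_nonzero: "rvar - rconst c \<noteq> 0"
proof -
  have "rvar - rconst c = to_fract [:- c, 1:]"
    by (simp add: rvar_def rconst_def flip: to_fract_diff)
  then show ?thesis by simp
qed

text \<open>Used with \<open>w\<close> and \<open>w'\<close> as the weights of index j and j - 1 and
  \<open>z\<close> as the node of index j. Multiplying through by \<open>w\<close> leaves only
  products and negations, which \<open>rconst\<close> respects.\<close>

lemma newton_denominator:
  assumes "w \<noteq> 0" "\<beta> * k = - (w' / w)" "\<beta> * h = - (z * w' / w)"
  shows "rconst w * (rconst \<beta> * (rconst h - rconst k * rvar)) = rconst w' * (rvar - rconst z)"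
proof -
  have "w * (\<beta> * k) = - w'" "w * (\<beta> * h) = - (z * w')"
    using assms by simp_all
  then have "rconst w * (rconst \<beta> * rconst k) = - rconst w'"
    "rconst w * (rconst \<beta> * rconst h) = - (rconst z * rconst w')"
    by (metis rconst_mult rconst_uminus)+
  moreover have "rconst w * (rconst \<beta> * (rconst h - rconst k * rvar)) =
      rconst w * (rconst \<beta> * rconst h) - rconst w * (rconst \<beta> * rconst k) * rvar"
    by (simp add: algebra_simps)
  ultimately show ?thesis
    by (simp only:) (simp add: algebra_simps)
qed

text \<open>Needed to pass from the cleared recursion to its quotient form: up to the factor
  \<open>rconst w\<close>, the denominator is a nonzero constant times the nonzero polynomial x -
  z.\<close>

lemma newton_denominator_nonzero:
  assumes "w \<noteq> 0" "w' \<noteq> 0" "\<beta> * k = - (w' / w)" "\<beta> * h = - (z * w' / w)"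
  shows "rconst \<beta> * (rconst h - rconst k * rvar) \<noteq> 0"
proof
  assume "rconst \<beta> * (rconst h - rconst k * rvar) = 0"
  then have "rconst w' * (rvar - rconst z) = 0"
    using newton_denominator[OF assms(1,3,4)] by (metis mult_zero_right)
  then show False
    using assms(2) rvar_minus_rconst_nonzero[of z] by simp
qed

text \<open>Each side is w_i w_j divided by the common barycentric sum. Were that sum 0, both sides
  would be 0, since division by 0 yields 0, so the identity holds in either case.\<close>

lemma bary_basis_cross_mult:
  "rconst (w i) * (rvar - rconst (z j)) * bary_basis m z w j =
   rconst (w j) * (rvar - rconst (z i)) * bary_basis m z w i"
  using rvar_minus_rconst_nonzero[of "z i"] rvar_minus_rconst_nonzero[of "z j"]
  by (simp add: bary_basis_def)

lemma bary_basis_newton_recursion: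
  assumes "w j \<noteq> 0" "\<beta> * k = - (w i / w j)" "\<beta> * h = - (z j * w i / w j)"
  shows "rconst \<beta> * (rconst h - rconst k * rvar) * bary_basis m z w j =
    (rvar - rconst (z i)) * bary_basis m z w i"
proof -
  \<comment> \<open>Scaling by w_j makes both previous identities applicable: the left side becomes
    w_i (x - z_j) r_j, which cross multiplication turns into w_j (x - z_i) r_i.\<close>
  have "rconst (w j) * (rconst \<beta> * (rconst h - rconst k * rvar) * bary_basis m z w j) =
      rconst (w j) * ((rvar - rconst (z i)) * bary_basis m z w i)"
    using newton_denominator[OF assms] bary_basis_cross_mult[of w i z j m]
    by (simp add: mult.assoc[symmetric])
  then show ?thesis using assms(1) by simp
qed

text \<open>The product of a row with a bidiagonal column: only the diagonal and subdiagonal entries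
  contribute, and the bound on j keeps both in range.\<close>

lemma sum_bidiagonal_column:
  fixes f :: "nat \<Rightarrow> 'a :: semiring_0"
  assumes "Suc j < n"
  shows "(\<Sum>i = 0..<n. f i * (if i = j then a else if i = Suc j then b else 0)) =
    f j * a + f (Suc j) * b"
proof -
  have "(\<Sum>i = 0..<n. f i * (if i = j then a else if i = Suc j then b else 0)) =
      (\<Sum>i \<in> {j, Suc j}. f i * (if i = j then a else if i = Suc j then b else 0))"
    using assms by (intro sum.mono_neutral_right) auto
  then show ?thesis by simp
qed

text \<open>Together with its counterpart for \<open>newton_N\<close>, this reduces the matrix
  identity to one scalar equation per column.\<close>

lemma bary_row_mult_newton_M:
  assumes "j < m"
  shows "((rvar \<cdot>\<^sub>m bary_row m z w) * map_mat rconst (newton_M m \<beta> k)) $$ (0, j) =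
    rvar * (bary_basis m z w j + rconst (\<beta> (Suc j)) * rconst (k (Suc j)) * bary_basis m z w (Suc j))"
  using assms sum_bidiagonal_column[of j "Suc m" "\<lambda>i. rvar * bary_basis m z w i" 1
      "rconst (\<beta> (Suc j)) * rconst (k (Suc j))"]
  by (simp add: bary_row_def newton_M_def scalar_prod_def mat_of_row_def if_distrib[of rconst]
      rconst_mult algebra_simps del: sum.op_ivl_Suc cong: if_cong)

lemma bary_row_mult_newton_N:
  assumes "j < m"
  shows "(bary_row m z w * map_mat rconst (newton_N m \<sigma> \<beta> h)) $$ (0, j) =
    rconst (\<sigma> j) * bary_basis m z w j
      + rconst (\<beta> (Suc j)) * rconst (h (Suc j)) * bary_basis m z w (Suc j)"
  using assms sum_bidiagonal_column[of j "Suc m" "bary_basis m z w" "rconst (\<sigma> j)"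
      "rconst (\<beta> (Suc j)) * rconst (h (Suc j))"]
  by (simp add: bary_row_def newton_N_def scalar_prod_def mat_of_row_def if_distrib[of rconst]
      rconst_mult algebra_simps del: sum.op_ivl_Suc cong: if_cong)

theorem mainTheorem3:
  fixes m :: nat and z w \<sigma> \<beta> h k :: "nat \<Rightarrow> complex"
  assumes "m \<ge> 1"
    and "inj_on z {0..m}"
    and "\<forall>j\<in>{0..m}. w j \<noteq> 0"
    and "\<forall>j\<in>{1..m}. \<sigma> (j - 1) = z (j - 1)"
    and "\<forall>j\<in>{1..m}. \<beta> j \<noteq> 0"
    and "\<forall>j\<in>{1..m}. \<beta> j * k j = - (w (j - 1) / w j)"
    and "\<forall>j\<in>{1..m}. \<beta> j * h j = - (z j * w (j - 1) / w j)"
  shows "(rvar \<cdot>\<^sub>m bary_row m z w) * map_mat rconst (newton_M m \<beta> k)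
           = bary_row m z w * map_mat rconst (newton_N m \<sigma> \<beta> h) \<and>
         (\<forall>j\<in>{1..m}. bary_basis m z w j =
           (rvar - rconst (\<sigma> (j - 1))) /
             (rconst (\<beta> j) * (rconst (h j) - rconst (k j) * rvar)) *
           bary_basis m z w (j - 1)) \<and>
         (\<forall>j\<in>{1..m}. \<beta> j \<noteq> 0 \<and> cmod (h j) + cmod (k j) \<noteq> 0 \<and> \<sigma> (j - 1) \<noteq> h j / k j)"
proof (intro conjI)
  \<comment> \<open>Indexed from 0 like the matrix columns: column j encodes the recursion from r_j
    to r_(j+1). Both the matrix identity and the quotient form are derived from it.\<close>
  have rec: "rconst (\<beta> (Suc j)) * (rconst (h (Suc j)) - rconst (k (Suc j)) * rvar)
      * bary_basis m z w (Suc j) = (rvar - rconst (\<sigma> j)) * bary_basis m z w j" if "j < m" for j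
    using bary_basis_newton_recursion[of w "Suc j" "\<beta> (Suc j)" "k (Suc j)" j "h (Suc j)" z m]
      assms that by (force simp: Ball_def dest: spec[of _ "Suc j"])
  show "(rvar \<cdot>\<^sub>m bary_row m z w) * map_mat rconst (newton_M m \<beta> k)
      = bary_row m z w * map_mat rconst (newton_N m \<sigma> \<beta> h)" (is "?A = ?B")
  proof (rule eq_matI)
    show "dim_row ?A = dim_row ?B" "dim_col ?A = dim_col ?B"
      by (simp_all add: newton_M_def newton_N_def)
    fix i j assume "i < dim_row ?B" "j < dim_col ?B"
    then have "i = 0" and j: "j < m"
      by (simp_all add: bary_row_def newton_N_def mat_of_row_def)
    show "?A $$ (i, j) = ?B $$ (i, j)"
      unfolding \<open>i = 0\<close> bary_row_mult_newton_M[OF j] bary_row_mult_newton_N[OF j]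
      \<comment> \<open>Collecting the multiples of x on one side of the cleared recursion gives
        exactly the equality of the two entries.\<close>
      using rec[OF j] by (simp add: algebra_simps)
  qed
  show "\<forall>j\<in>{1..m}. bary_basis m z w j = (rvar - rconst (\<sigma> (j - 1))) /
      (rconst (\<beta> j) * (rconst (h j) - rconst (k j) * rvar)) * bary_basis m z w (j - 1)"
  proof
    fix j assume j: "j \<in> {1..m}"
    then have "w j \<noteq> 0" "w (j - 1) \<noteq> 0" using assms(3) by auto
    then have "rconst (\<beta> j) * (rconst (h j) - rconst (k j) * rvar) \<noteq> 0"
      using newton_denominator_nonzero assms(6,7) j by blast
    moreover have "rconst (\<beta> j) * (rconst (h j) - rconst (k j) * rvar) * bary_basis m z w j =
        (rvar - rconst (\<sigma> (j - 1))) * bary_basis m z w (j - 1)"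
      using rec[of "j - 1"] j by (cases j) simp_all
    ultimately show "bary_basis m z w j = (rvar - rconst (\<sigma> (j - 1))) /
        (rconst (\<beta> j) * (rconst (h j) - rconst (k j) * rvar)) * bary_basis m z w (j - 1)"
      by (metis nonzero_mult_div_cancel_left times_divide_eq_left)
  qed
  show "\<forall>j\<in>{1..m}. \<beta> j \<noteq> 0 \<and> cmod (h j) + cmod (k j) \<noteq> 0 \<and> \<sigma> (j - 1) \<noteq> h j / k j"
  proof
    fix j assume j: "j \<in> {1..m}"
    then have w: "w j \<noteq> 0" "w (j - 1) \<noteq> 0" using assms(3) by auto
    have b: "\<beta> j \<noteq> 0" and bk: "\<beta> j * k j = - (w (j - 1) / w j)"
      and bh: "\<beta> j * h j = - (z j * w (j - 1) / w j)"
      using assms(5-7) j by blast+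
    \<comment> \<open>This makes h_j / k_j a genuine quotient rather than the default value 0. It
      equals z_j, so it differs from \<sigma>_(j-1) = z_(j-1) because the nodes are
      distinct.\<close>
    have k: "k j \<noteq> 0" using bk w by auto
    have "\<beta> j * h j = \<beta> j * (z j * k j)"
      using bk bh by (simp add: mult.left_commute[of "\<beta> j"])
    then have "h j / k j = z j" using b k by simp
    moreover have "z (j - 1) \<noteq> z j"
      using inj_onD[OF assms(2), of "j - 1" j] j by (cases j) auto
    moreover have "cmod (h j) + cmod (k j) > 0"
      using k by (simp add: add_nonneg_pos)
    ultimately show "\<beta> j \<noteq> 0 \<and> cmod (h j) + cmod (k j) \<noteq> 0 \<and> \<sigma> (j - 1) \<noteq> h j / k j"
      using b assms(4) j by simp
  qed
qed

end
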